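(* Let $r\ge2$, let $q\in\mathbb C$ with $0<|q|<1$, and let $a_1,\dots,a_r,b_1,\dots,b_r$ be nonzero complex numbers with $b_r=q$, such that no quotient $b_i/b_j$ with $i\ne j$ is an integral power of $q$. Set $$c_i(q):=q\,b_i^{r-2}\prod_{\substack{1\le j\le r\\ j\ne i}}\frac{1}{b_i-b_j},\qquad i=1,\dots,r.$$ Let $f_i(q;z)$, $g_i(q;z)$ ($1\le i\le r$) be the solutions of the basic hypergeometric equation and of its dual, as defined in the context, and let $H_q$ be the field generated over $\mathbb Q$ by $q$, the $a_i$ and the $b_j$. Then for all $k,l\in\{0,1,\dots,r-1\}$, $$M_{kl}(q):=\sum_{i=1}^r c_i(q)\,f_i(q;zq^k)\,g_i(q;zq^l)\in H_q(z).$$ In particular, $M_{kl}(q)=0$ if $l\le k\le r-1$, except when $(k,l)=(r-1,0)$, in which case $$M_{r-1,0}(q)=\frac{(-1)^{r+1}q^r}{b_1\cdots b_r-a_1\cdots a_r\,q^{r-1}z}.$$ In addition, $$M_{k,k+1}(q)=\frac{1}{1-q^kz},\qquad k=0,1,\dots,r-2.$$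
   Context: $(a;q)_0:=1$ and $(a;q)_n:=(1-a)(1-aq)\cdots(1-aq^{n-1})$ for $n\ge1$. For $1\le i\le r$, $\beta_i$ is thought of as $\log(b_i)/\log(q)$, and $z^{1-\beta_i}$ denotes a formal nonzero solution of $h(qz)=(q/b_i)h(z)$; $z^{\beta_i-1}$ is its inverse, so it satisfies $h(qz)=(b_i/q)h(z)$ and $z^{1-\beta_i}z^{\beta_i-1}=1$. Define $$f_i(q;z):=z^{1-\beta_i}\sum_{n\ge0}\frac{\prod_{j=1}^r(qa_j/b_i;q)_n}{\prod_{j=1}^r(qb_j/b_i;q)_n}z^n,$$ $$g_i(q;z):=z^{\beta_i-1}\sum_{n\ge0}\frac{\prod_{j=1}^r(b_i/a_j;q)_n}{\prod_{j=1}^r(qb_i/b_j;q)_n}\left(\frac{a_1\cdots a_r\,q^{r-2}z}{b_1\cdots b_{r-1}}\right)^n$$ (the factor $j=i$ in each denominator is $(q;q)_n$). Thus $f_i(q;zq^k)g_i(q;zq^l)$ equals $(q/b_i)^{k-l}$ times the product of the first power series evaluated at $q^kz$ and the second evaluated at $q^lz$. Membership in $H_q(z)$ means that the resulting power series in $z$ is the expansion at $z=0$ of a rational function with coefficients in $H_q$. *)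

theory Defs
  imports
    "HOL-Computational_Algebra.Formal_Power_Series"
    "HOL-Computational_Algebra.Polynomial_FPS"
    "HOL-Algebra.Generated_Fields"
    "HOL-Algebra.Algebraic_Closure_Type"
    "HOL-Library.Function_Algebras"
begin

definition qpochhammer :: "complex \<Rightarrow> complex \<Rightarrow> nat \<Rightarrow> complex" where
  "qpochhammer a q n = (\<Prod>k<n. 1 - a * q ^ k)"

(* A commutative difference ring extending the formal power series in z: \<iota> is the embedding and
   \<sigma> is the q-shift h(z) |-> h(qz).  It is the ambient ring for the formal solutions
   z^(1-\<beta>) of h(qz) = (q/b) h(z). *)
locale q_difference_extension =
  fixes q :: complex
    and \<iota> :: "complex fps \<Rightarrow> 'a :: comm_ring_1"
    and \<sigma> :: "'a \<Rightarrow> 'a"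
  assumes \<iota>_one: "\<iota> 1 = 1"
    and \<iota>_add: "\<iota> (F + G) = \<iota> F + \<iota> G"
    and \<iota>_mult: "\<iota> (F * G) = \<iota> F * \<iota> G"
    and \<iota>_inj: "inj \<iota>"
    and \<sigma>_one: "\<sigma> 1 = 1"
    and \<sigma>_add: "\<sigma> (x + y) = \<sigma> x + \<sigma> y"
    and \<sigma>_mult: "\<sigma> (x * y) = \<sigma> x * \<sigma> y"
    and \<sigma>_\<iota>: "\<sigma> (\<iota> F) = \<iota> (fps_compose F (fps_const q * fps_X))"

(* For every q there is such a ring containing, for all multipliers \<mu> i \<noteq> 0, invertible solutions
   of h(qz) = \<mu> i h(z): sequences of power series, an element h being recorded by
   h(z), h(qz), h(q^2 z), ... *)
lemma q_difference_extension_exists: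
  fixes q :: complex and \<mu> :: "nat \<Rightarrow> complex"
  assumes "\<And>i. \<mu> i \<noteq> 0"
  shows "\<exists>(\<iota> :: complex fps \<Rightarrow> nat \<Rightarrow> complex fps) \<sigma> h h'. q_difference_extension q \<iota> \<sigma> \<and>
           (\<forall>i. \<sigma> (h i) = \<iota> (fps_const (\<mu> i)) * h i \<and> h i * h' i = 1)"
proof -
  define \<iota> :: "complex fps \<Rightarrow> nat \<Rightarrow> complex fps"
    where "\<iota> F k = fps_compose F (fps_const (q ^ k) * fps_X)" for F k
  define \<sigma> :: "(nat \<Rightarrow> complex fps) \<Rightarrow> nat \<Rightarrow> complex fps" where "\<sigma> x k = x (Suc k)" for x k
  define h where "h i k = fps_const (\<mu> i ^ k)" for i k :: nat
  define h' where "h' i k = fps_const (inverse (\<mu> i ^ k))" for i k :: nat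
  have "q_difference_extension q \<iota> \<sigma>"
  proof
    show "inj \<iota>"
    proof (rule injI)
      fix F G assume "\<iota> F = \<iota> G"
      then have "\<iota> F 0 = \<iota> G 0" by simp
      then show "F = G" by (simp add: \<iota>_def)
    qed
    show "\<sigma> (\<iota> F) = \<iota> (fps_compose F (fps_const q * fps_X))" for F
    proof
      fix k
      show "\<sigma> (\<iota> F) k = \<iota> (fps_compose F (fps_const q * fps_X)) k"
        unfolding \<iota>_def \<sigma>_def fps_compose_linear
        by (simp add: fps_eq_iff power_mult_distrib)
    qed
  qed (auto simp: \<iota>_def \<sigma>_def fun_eq_iff fps_compose_mult_distrib fps_compose_add_distrib)
  moreover have "\<sigma> (h i) = \<iota> (fps_const (\<mu> i)) * h i \<and> h i * h' i = 1" for i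
    using assms[of i] by (auto simp: \<iota>_def \<sigma>_def h_def h'_def fun_eq_iff)
  ultimately show ?thesis by blast
qed

definition f_series :: "complex \<Rightarrow> nat \<Rightarrow> (nat \<Rightarrow> complex) \<Rightarrow> (nat \<Rightarrow> complex) \<Rightarrow> nat \<Rightarrow> complex fps"
  where "f_series q r a b i = Abs_fps (\<lambda>n.
    (\<Prod>j=1..r. qpochhammer (q * a j / b i) q n) / (\<Prod>j=1..r. qpochhammer (q * b j / b i) q n))"

definition g_series :: "complex \<Rightarrow> nat \<Rightarrow> (nat \<Rightarrow> complex) \<Rightarrow> (nat \<Rightarrow> complex) \<Rightarrow> nat \<Rightarrow> complex fps"
  where "g_series q r a b i = Abs_fps (\<lambda>n.
    (\<Prod>j=1..r. qpochhammer (b i / a j) q n) / (\<Prod>j=1..r. qpochhammer (q * b i / b j) q n)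
      * ((\<Prod>j=1..r. a j) * q ^ (r - 2) / (\<Prod>j=1..r-1. b j)) ^ n)"

definition c_coeff :: "complex \<Rightarrow> nat \<Rightarrow> (nat \<Rightarrow> complex) \<Rightarrow> nat \<Rightarrow> complex" where
  "c_coeff q r b i = q * b i ^ (r - 2) * (\<Prod>j\<in>{1..r} - {i}. 1 / (b i - b j))"

(* h i stands for z^(1-\<beta>_i) and h' i for its inverse z^(\<beta>_i-1). *)
definition f_sol ::
  "complex \<Rightarrow> nat \<Rightarrow> (nat \<Rightarrow> complex) \<Rightarrow> (nat \<Rightarrow> complex) \<Rightarrow>
   (complex fps \<Rightarrow> 'a :: comm_ring_1) \<Rightarrow> (nat \<Rightarrow> 'a) \<Rightarrow> nat \<Rightarrow> 'a"
  where "f_sol q r a b \<iota> h i = h i * \<iota> (f_series q r a b i)"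

definition g_sol ::
  "complex \<Rightarrow> nat \<Rightarrow> (nat \<Rightarrow> complex) \<Rightarrow> (nat \<Rightarrow> complex) \<Rightarrow>
   (complex fps \<Rightarrow> 'a :: comm_ring_1) \<Rightarrow> (nat \<Rightarrow> 'a) \<Rightarrow> nat \<Rightarrow> 'a"
  where "g_sol q r a b \<iota> h' i = h' i * \<iota> (g_series q r a b i)"

(* (\<sigma> ^^ k) x is x(zq^k). *)
definition M_entry ::
  "complex \<Rightarrow> nat \<Rightarrow> (nat \<Rightarrow> complex) \<Rightarrow> (nat \<Rightarrow> complex) \<Rightarrow>
   (complex fps \<Rightarrow> 'a :: comm_ring_1) \<Rightarrow> ('a \<Rightarrow> 'a) \<Rightarrow> (nat \<Rightarrow> 'a) \<Rightarrow> (nat \<Rightarrow> 'a) \<Rightarrow> nat \<Rightarrow> nat \<Rightarrow> 'a"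
  where "M_entry q r a b \<iota> \<sigma> h h' k l =
    (\<Sum>i=1..r. \<iota> (fps_const (c_coeff q r b i))
       * (\<sigma> ^^ k) (f_sol q r a b \<iota> h i)
       * (\<sigma> ^^ l) (g_sol q r a b \<iota> h' i))"

(* A subfield of the complex numbers contains the rationals, so nothing has to be adjoined
   for "over Q". *)
definition H_field :: "complex \<Rightarrow> nat \<Rightarrow> (nat \<Rightarrow> complex) \<Rightarrow> (nat \<Rightarrow> complex) \<Rightarrow> complex set" where
  "H_field q r a b = generate_field ring_of_type_algebra ({q} \<union> a ` {1..r} \<union> b ` {1..r})"

(* Expansions at z = 0 of the rational functions over K that are regular there. *)
definition rational_fps :: "complex set \<Rightarrow> complex fps set" where
  "rational_fps K = {fps_of_poly p / fps_of_poly d | p d.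
     (\<forall>n. poly.coeff p n \<in> K) \<and> (\<forall>n. poly.coeff d n \<in> K) \<and> poly.coeff d 0 \<noteq> 0}"

end

theory Submission
  imports Defs
begin

text \<open>
  After cancelling the factors \<open>z\<^sup>1\<^sup>-\<^sup>\<beta>\<close> and their inverses, \<open>M\<^sub>k\<^sub>l\<close> is a power series, and its coefficient of
  \<open>z\<^sup>N\<close> is a double sum over \<open>i\<close> and \<open>n + m = N\<close>. The whole argument rests on reading this double
  sum as a sum of residues. Up to an explicit monomial factor, the summand is the residue at
  \<open>x = b\<^sub>i / q\<^sup>n\<close> of \<open>x\<^sup>s\<close> times
  \[ \prod_{j} \frac{\prod_{t < N} (x - a_j q^{-t})}{\prod_{t \le N} (x - b_j q^{-t})},
     \qquad s = r - 2 + l - k, \]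
  where the numerator has degree \<open>r N\<close> and the \<open>r (N + 1)\<close> roots of the denominator are distinct by
  genericity of the \<open>b\<^sub>j\<close>
  (lemma \<open>f_g_coeff_eq_residue_weight\<close>). By partial fractions the sum of these residues is read off
  from the expansion at infinity (lemma \<open>sum_residue_weight_power\<close>): it is \<open>0\<close> for \<open>0 \<le> s < r - 1\<close>
  and \<open>1\<close> for \<open>s = r - 1\<close>, which gives the vanishing for \<open>l \<le> k\<close> and the geometric series
  \<open>1 / (1 - q\<^sup>k z)\<close> for \<open>l = k + 1\<close>. For \<open>s = -1\<close>, that is \<open>(k, l) = (r - 1, 0)\<close>, the only other pole
  is \<open>x = 0\<close>, and its residue gives the corner entry (lemma \<open>sum_residue_weight_inverse\<close>).

  For \<open>l > k\<close> in general, with \<open>e = l - k - 1\<close>, the sum of residues is the coefficient of \<open>w\<^sup>e\<close> in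
  \[ W_N(w) = \prod_{j} \frac{\prod_{t < N} (1 - a_j q^{-t} w)}{\prod_{t \le N} (1 - b_j q^{-t} w)}. \]
  These series satisfy \<open>W\<^sub>N\<^sub>+\<^sub>1(w) = R(w) W\<^sub>N(w/q)\<close>, where \<open>R(w)\<close> is the product of the
  \<open>(1 - a\<^sub>j w) / (1 - b\<^sub>j w)\<close>. On generating functions \<open>Y\<^sub>e(z)\<close> of the coefficients of \<open>w\<^sup>e\<close> this
  says that \<open>(1 - q\<^sup>-\<^sup>e z) Y\<^sub>e\<close> is a constant plus \<open>z\<close> times a linear combination of the \<open>Y\<^sub>d\<close> with
  \<open>d < e\<close>, all with coefficients in the field \<open>H\<^sub>q\<close>; hence \<open>Y\<^sub>e\<close> is rational over \<open>H\<^sub>q\<close> by induction on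
  \<open>e\<close> (lemma \<open>grid_ratio_generating_function_rational\<close>).
\<close>

section \<open>Sums of residues of rational functions\<close>

lemma lagrange_interpolation:
  fixes x :: "'i \<Rightarrow> complex" and p :: "complex poly"
  assumes fin: "finite I" and inj: "inj_on x I" and deg: "Polynomial.degree p < card I"
  shows "p = (\<Sum>i\<in>I. Polynomial.smult (poly p (x i) / (\<Prod>j\<in>I-{i}. x i - x j)) (\<Prod>j\<in>I-{i}. [:- x j, 1:]))"
    (is "_ = ?R")
proof (rule poly_eqI_degree[of "x ` I"])
  have card: "card (x ` I) = card I" using inj by (rule card_image)
  show "Polynomial.degree p < card (x ` I)" using deg card by simp
  have "Polynomial.degree ?R \<le> card I - 1"
  proof (rule degree_sum_le[OF fin])
    fix i assume "i \<in> I"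
    then have "Polynomial.degree (\<Prod>j\<in>I-{i}. [:- x j, 1:]) \<le> card I - 1"
      using degree_prod_sum_le[of "I-{i}" "\<lambda>j. [:- x j, 1:]"] fin by simp
    then show "Polynomial.degree (Polynomial.smult (poly p (x i) / (\<Prod>j\<in>I-{i}. x i - x j)) (\<Prod>j\<in>I-{i}. [:- x j, 1:]))
        \<le> card I - 1"
      using degree_smult_le le_trans by blast
  qed
  then show "Polynomial.degree ?R < card (x ` I)" using deg card by linarith
next
  fix z assume "z \<in> x ` I"
  then obtain i where i: "i \<in> I" "z = x i" by blast
  have *: "(\<Prod>j\<in>I-{k}. x i - x j) = 0" if "k \<in> I - {i}" for k
    using that i fin by (intro prod_zero) auto
  have nz: "(\<Prod>j\<in>I-{i}. x i - x j) \<noteq> 0"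
    using i fin inj by (auto simp: inj_on_def)
  have "poly ?R z = (\<Sum>k\<in>I. poly p (x k) / (\<Prod>j\<in>I-{k}. x k - x j) * (\<Prod>j\<in>I-{k}. x i - x j))"
    by (simp add: poly_sum poly_prod i algebra_simps)
  also have "\<dots> = poly p (x i) / (\<Prod>j\<in>I-{i}. x i - x j) * (\<Prod>j\<in>I-{i}. x i - x j)"
    using i fin by (subst sum.remove[of _ i]) (simp_all add: *)
  finally show "poly p z = poly ?R z" using nz i by simp
qed

text \<open>
  The residue at \<open>z = x i\<close> of the product of the \<open>z - y j\<close> for \<open>j \<in> J\<close> divided by the product of the
  \<open>z - x i\<close> for \<open>i \<in> I\<close>, the \<open>x i\<close> being distinct. The \<open>y j\<close> may repeat or coincide with some \<open>x i\<close>.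
\<close>

definition residue_weight :: "'i set \<Rightarrow> ('i \<Rightarrow> complex) \<Rightarrow> 'j set \<Rightarrow> ('j \<Rightarrow> complex) \<Rightarrow> 'i \<Rightarrow> complex" where
  "residue_weight I x J y i = (\<Prod>j\<in>J. x i - y j) / (\<Prod>j\<in>I-{i}. x i - x j)"

lemma partial_fractions_eval:
  assumes fin: "finite I" "finite J" and inj: "inj_on x I" and card: "card J < card I"
  shows "(\<Prod>j\<in>J. z - y j) = (\<Sum>i\<in>I. residue_weight I x J y i * (\<Prod>j\<in>I-{i}. z - x j))"
proof -
  define p where "p = (\<Prod>j\<in>J. [:- y j, 1:])"
  have "Polynomial.degree p \<le> card J"
    unfolding p_def using degree_prod_sum_le[of J "\<lambda>j. [:- y j, 1:]"] fin by simp
  with card have "Polynomial.degree p < card I" by simp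
  from arg_cong[OF lagrange_interpolation[OF fin(1) inj this], of "\<lambda>p. poly p z"]
  show ?thesis
    by (simp add: poly_sum poly_prod residue_weight_def p_def)
qed

text \<open>
  The residues of the same function divided by \<open>z\<close>: the right-hand side is minus the residue at the
  additional pole \<open>0\<close>, and infinity contributes nothing because there are fewer zeros than poles.
\<close>

lemma sum_residue_weight_inverse:
  assumes fin: "finite I" "finite J" and inj: "inj_on x I" and card: "card J < card I"
    and nz: "\<And>i. i \<in> I \<Longrightarrow> x i \<noteq> 0"
  shows "(\<Sum>i\<in>I. residue_weight I x J y i / x i) = - (\<Prod>j\<in>J. - y j) / (\<Prod>i\<in>I. - x i)"
proof -
  have P: "(\<Prod>i\<in>I. - x i) \<noteq> 0" using nz fin by auto
  have "(\<Prod>j\<in>J. - y j) = (\<Sum>i\<in>I. residue_weight I x J y i * (\<Prod>j\<in>I-{i}. - x j))"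
    using partial_fractions_eval[OF fin inj card, of 0 y] by simp
  also have "\<dots> = (\<Sum>i\<in>I. - (residue_weight I x J y i / x i) * (\<Prod>i\<in>I. - x i))"
    using fin nz by (intro sum.cong refl) (simp add: prod.remove)
  also have "\<dots> = - (\<Sum>i\<in>I. residue_weight I x J y i / x i) * (\<Prod>i\<in>I. - x i)"
    by (simp only: sum_distrib_right flip: sum_negf)
  finally show ?thesis using P by (simp add: field_simps)
qed

text \<open>The partial fraction decomposition in the coordinate \<open>w = 1/z\<close> at infinity, with denominators cleared.\<close>

lemma partial_fractions_reversed:
  fixes x :: "'i \<Rightarrow> complex" and y :: "'j \<Rightarrow> complex"
  assumes fin: "finite I" "finite J" and inj: "inj_on x I" and card: "card I = Suc (card J + d)"
  shows "(\<Sum>i\<in>I. Polynomial.smult (residue_weight I x J y i) (\<Prod>j\<in>I-{i}. [:1, - x j:])) =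
    Polynomial.monom 1 d * (\<Prod>j\<in>J. [:1, - y j:])" (is "?L = ?R")
proof -
  have eq: "poly ?L w = poly ?R w" if w: "w \<noteq> 0" for w
  proof -
    have scale: "w ^ card A * (\<Prod>j\<in>A. inverse w - g j) = (\<Prod>j\<in>A. 1 - g j * w)"
      if "finite A" for A and g :: "'c \<Rightarrow> complex"
      using that w by (subst prod_constant[symmetric], subst prod.distrib[symmetric])
        (auto simp: field_simps intro!: prod.cong)
    have scale': "w ^ (card J + d) * (\<Prod>j\<in>I-{i}. inverse w - x j) = (\<Prod>j\<in>I-{i}. 1 - x j * w)" if "i \<in> I" for i
      using scale[of "I-{i}" x] fin that card by simp
    have "poly ?R w = w ^ d * (w ^ card J * (\<Prod>j\<in>J. inverse w - y j))"
      using scale[OF fin(2), of y] by (simp add: poly_monom poly_prod mult.commute)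
    also have "\<dots> = w ^ (card J + d) * (\<Prod>j\<in>J. inverse w - y j)"
      by (simp add: power_add)
    also have "\<dots> = (\<Sum>i\<in>I. residue_weight I x J y i * (w ^ (card J + d) * (\<Prod>j\<in>I-{i}. inverse w - x j)))"
      using card by (subst partial_fractions_eval[OF fin inj]) (simp_all add: sum_distrib_left mult_ac)
    also have "\<dots> = poly ?L w"
      using scale' by (simp add: poly_sum poly_prod mult.commute)
    finally show ?thesis by simp
  qed
  have "infinite {w. poly (?L - ?R) w = 0}"
  proof (rule infinite_super)
    show "- {0} \<subseteq> {w. poly (?L - ?R) w = 0}" using eq by auto
    show "infinite (- {0 :: complex})" by (simp add: infinite_UNIV_char_0)
  qed
  \<comment> \<open>The point \<open>w = 0\<close>, excluded above, is recovered because two polynomials agree at infinitely many points.\<close>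
  then have "?L - ?R = 0" using poly_roots_finite by blast
  then show ?thesis by simp
qed

text \<open>The power series of the quotient of the products of \<open>1 - y j w\<close> over \<open>J\<close> and of \<open>1 - x i w\<close> over \<open>I\<close>.\<close>

definition linear_ratio :: "'j set \<Rightarrow> ('j \<Rightarrow> complex) \<Rightarrow> 'i set \<Rightarrow> ('i \<Rightarrow> complex) \<Rightarrow> complex fps" where
  "linear_ratio J y I x =
     (\<Prod>j\<in>J. 1 - fps_const (y j) * fps_X) * inverse (\<Prod>i\<in>I. 1 - fps_const (x i) * fps_X)"

lemma fps_prod_nth_0: "fps_nth (\<Prod>i\<in>I. F i) 0 = (\<Prod>i\<in>I. fps_nth (F i) 0)"
  by (induction I rule: infinite_finite_induct) auto

lemma inverse_one_minus_const_fps_X: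
  "inverse (1 - fps_const c * fps_X) = Abs_fps (\<lambda>s. c ^ s)" for c :: complex
  by (rule fps_inverse_unique)
    (auto simp: fps_eq_iff algebra_simps fps_mult_left_const_nth gr0_conv_Suc power_eq_if)

text \<open>
  The sum of the residues of \<open>z\<^sup>s\<close> times the rational function is a coefficient of its expansion at
  infinity; \<open>d + 1\<close> is the excess of poles over zeros.
\<close>

lemma sum_residue_weight_power:
  fixes x :: "'i \<Rightarrow> complex" and y :: "'j \<Rightarrow> complex"
  assumes fin: "finite I" "finite J" and inj: "inj_on x I" and card: "card I = Suc (card J + d)"
  shows "(\<Sum>i\<in>I. residue_weight I x J y i * x i ^ s) = fps_nth (fps_X ^ d * linear_ratio J y I x) s"
proof -
  let ?D = "\<Prod>i\<in>I. 1 - fps_const (x i) * fps_X"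
  have lin: "fps_of_poly [:1, - c:] = 1 - fps_const c * fps_X" for c :: complex
    by (simp add: fps_of_poly_pCons flip: fps_const_neg)
  have D0: "fps_nth ?D 0 = 1" by (simp add: fps_prod_nth_0)
  have DD: "?D * inverse ?D = 1" using D0 inverse_mult_eq_1'[of ?D] by simp
  have "fps_X ^ d * (\<Prod>j\<in>J. 1 - fps_const (y j) * fps_X) =
    (\<Sum>i\<in>I. fps_const (residue_weight I x J y i) * (\<Prod>j\<in>I-{i}. 1 - fps_const (x j) * fps_X))"
    using arg_cong[OF partial_fractions_reversed[OF fin inj card, of y], of fps_of_poly]
    by (simp add: fps_of_poly_sum fps_of_poly_smult fps_of_poly_prod fps_of_poly_mult fps_of_poly_monom lin)
  then have "fps_X ^ d * linear_ratio J y I x =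
    (\<Sum>i\<in>I. fps_const (residue_weight I x J y i) * (\<Prod>j\<in>I-{i}. 1 - fps_const (x j) * fps_X)) * inverse ?D"
    by (simp add: linear_ratio_def mult.assoc)
  also have "\<dots> = (\<Sum>i\<in>I. fps_const (residue_weight I x J y i) * inverse (1 - fps_const (x i) * fps_X))"
    unfolding sum_distrib_right
  proof (rule sum.cong)
    fix i assume i: "i \<in> I"
    let ?E = "\<Prod>j\<in>I-{i}. 1 - fps_const (x j) * fps_X" and ?l = "1 - fps_const (x i) * fps_X"
    have "?D = ?l * ?E" using fin i by (simp add: prod.remove)
    then have "?E * inverse ?D = inverse ?l * (?E * inverse ?E)"
      by (simp add: fps_inverse_mult mult_ac)
    also have "?E * inverse ?E = 1" using inverse_mult_eq_1'[of ?E] by (simp add: fps_prod_nth_0)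
    finally show "fps_const (residue_weight I x J y i) * ?E * inverse ?D =
       fps_const (residue_weight I x J y i) * inverse ?l" by (simp add: mult.assoc)
  qed simp
  finally show ?thesis by (simp add: inverse_one_minus_const_fps_X fps_sum_nth)
qed

section \<open>Rational power series over a subring\<close>

text \<open>
  A subring of \<open>\<complex>\<close>. Division is not needed for the closure properties below: power series are only
  inverted when their constant coefficient is \<open>1\<close>, and rational ones only divided by \<open>1 - c z\<close>.
\<close>

locale complex_subring =
  fixes K :: "complex set"
  assumes one_in: "1 \<in> K"
    and uminus_in: "x \<in> K \<Longrightarrow> - x \<in> K"
    and add_in: "x \<in> K \<Longrightarrow> y \<in> K \<Longrightarrow> x + y \<in> K"
    and mult_in: "x \<in> K \<Longrightarrow> y \<in> K \<Longrightarrow> x * y \<in> K"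
begin

lemma zero_in: "0 \<in> K"
  using add_in[OF one_in uminus_in[OF one_in]] by simp

lemma diff_in: "x \<in> K \<Longrightarrow> y \<in> K \<Longrightarrow> x - y \<in> K"
  using add_in[of x "- y"] uminus_in by simp

lemma sum_in: "(\<And>i. i \<in> I \<Longrightarrow> g i \<in> K) \<Longrightarrow> (\<Sum>i\<in>I. g i) \<in> K"
  by (induction I rule: infinite_finite_induct) (auto intro: zero_in add_in)

lemma prod_in: "(\<And>i. i \<in> I \<Longrightarrow> g i \<in> K) \<Longrightarrow> (\<Prod>i\<in>I. g i) \<in> K"
  by (induction I rule: infinite_finite_induct) (auto intro: one_in mult_in)

lemma power_in: "x \<in> K \<Longrightarrow> x ^ n \<in> K"
  by (induction n) (auto intro: one_in mult_in)

lemmas closed = zero_in one_in uminus_in add_in mult_in diff_in sum_in prod_in power_in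

lemma fps_mult_coeffs_in:
  "(\<And>n. fps_nth F n \<in> K) \<Longrightarrow> (\<And>n. fps_nth G n \<in> K) \<Longrightarrow> fps_nth (F * G) n \<in> K"
  by (auto simp: fps_mult_nth intro!: closed)

lemma fps_prod_coeffs_in:
  "(\<And>i n. i \<in> I \<Longrightarrow> fps_nth (F i) n \<in> K) \<Longrightarrow> fps_nth (\<Prod>i\<in>I. F i) n \<in> K"
proof (induction I arbitrary: n rule: infinite_finite_induct)
  case (insert i I)
  then show ?case by (simp add: fps_mult_coeffs_in)
qed (auto intro: closed)

lemma fps_inverse_coeffs_in:
  assumes "\<And>n. fps_nth F n \<in> K" and "fps_nth F 0 = 1"
  shows "fps_nth (inverse F) n \<in> K"
proof (induction n rule: less_induct)
  case (less n)
  show ?case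
  proof (cases n)
    case 0
    then show ?thesis using assms by (simp add: closed)
  next
    case (Suc m)
    have "fps_nth (F * inverse F) n = 0"
      using assms(2) Suc by (simp add: inverse_mult_eq_1')
    then have "fps_nth (inverse F) n + (\<Sum>i=1..n. fps_nth F i * fps_nth (inverse F) (n - i)) = 0"
      using assms(2) by (simp add: fps_mult_nth sum.atLeast_Suc_atMost)
    then have "fps_nth (inverse F) n = - (\<Sum>i=1..n. fps_nth F i * fps_nth (inverse F) (n - i))"
      by (simp add: eq_neg_iff_add_eq_0)
    then show ?thesis using less assms(1) by (auto intro!: closed)
  qed
qed

lemma linear_ratio_coeffs_in:
  assumes "\<And>j. j \<in> J \<Longrightarrow> y j \<in> K" and "\<And>i. i \<in> I \<Longrightarrow> x i \<in> K"
  shows "fps_nth (linear_ratio J y I x) n \<in> K"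
proof -
  have lin: "fps_nth (1 - fps_const c * fps_X) n \<in> K" if "c \<in> K" for c n
    using that by (auto intro: closed)
  show ?thesis
    unfolding linear_ratio_def
    by (intro fps_mult_coeffs_in fps_prod_coeffs_in fps_inverse_coeffs_in lin assms)
      (auto simp: fps_prod_nth_0)
qed

lemma poly_mult_coeffs_in:
  "(\<And>n. poly.coeff p n \<in> K) \<Longrightarrow> (\<And>n. poly.coeff p' n \<in> K) \<Longrightarrow> poly.coeff (p * p') n \<in> K"
  by (auto simp: coeff_mult intro!: closed)

lemma rational_fpsI:
  assumes "\<And>n. poly.coeff p n \<in> K" "\<And>n. poly.coeff d n \<in> K" "poly.coeff d 0 \<noteq> 0"
    and "F * fps_of_poly d = fps_of_poly p"
  shows "F \<in> rational_fps K"
proof -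
  have "fps_of_poly d \<noteq> 0" using assms(3) by auto
  then have "F = fps_of_poly p / fps_of_poly d" using assms(4) by (metis nonzero_mult_div_cancel_right)
  then show ?thesis using assms unfolding rational_fps_def by blast
qed

lemma rational_fpsE:
  assumes "F \<in> rational_fps K"
  obtains p d where "\<And>n. poly.coeff p n \<in> K" "\<And>n. poly.coeff d n \<in> K" "poly.coeff d 0 \<noteq> 0"
    and "F * fps_of_poly d = fps_of_poly p"
proof -
  from assms obtain p d where *: "\<And>n. poly.coeff p n \<in> K" "\<And>n. poly.coeff d n \<in> K"
    "poly.coeff d 0 \<noteq> 0" "F = fps_of_poly p / fps_of_poly d"
    unfolding rational_fps_def by blast
  then have "F * fps_of_poly d = fps_of_poly p * (inverse (fps_of_poly d) * fps_of_poly d)"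
    by (simp add: fps_divide_unit mult.assoc)
  also have "inverse (fps_of_poly d) * fps_of_poly d = 1"
    using * by (simp add: inverse_mult_eq_1)
  finally have "F * fps_of_poly d = fps_of_poly p" by simp
  then show ?thesis using that *(1-3) by blast
qed

lemma rational_fps_of_poly: "(\<And>n. poly.coeff p n \<in> K) \<Longrightarrow> fps_of_poly p \<in> rational_fps K"
  by (rule rational_fpsI[of p 1]) (auto simp: coeff_1 intro: closed)

lemma rational_fps_const: "c \<in> K \<Longrightarrow> fps_const c \<in> rational_fps K"
  using rational_fps_of_poly[of "[:c:]"] zero_in
  by (auto simp: fps_of_poly_const coeff_pCons split: nat.splits)

lemma rational_fps_X: "fps_X \<in> rational_fps K"
  using rational_fps_of_poly[of "[:0, 1:]"] zero_in one_in
  by (auto simp: coeff_pCons split: nat.splits)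

lemma rational_fps_add:
  assumes "F \<in> rational_fps K" "G \<in> rational_fps K"
  shows "F + G \<in> rational_fps K"
proof -
  obtain p d where 1: "\<And>n. poly.coeff p n \<in> K" "\<And>n. poly.coeff d n \<in> K" "poly.coeff d 0 \<noteq> 0"
    and F: "F * fps_of_poly d = fps_of_poly p" using assms(1) by (rule rational_fpsE) blast
  obtain p' d' where 2: "\<And>n. poly.coeff p' n \<in> K" "\<And>n. poly.coeff d' n \<in> K" "poly.coeff d' 0 \<noteq> 0"
    and G: "G * fps_of_poly d' = fps_of_poly p'" using assms(2) by (rule rational_fpsE) blast
  have "(F + G) * fps_of_poly (d * d') = fps_of_poly (p * d' + p' * d)"
    by (simp add: fps_of_poly_add fps_of_poly_mult algebra_simps flip: F G)
  then show ?thesis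
    using 1 2 by (intro rational_fpsI[of "p * d' + p' * d" "d * d'"])
      (auto simp: coeff_mult_0 intro!: add_in poly_mult_coeffs_in)
qed

lemma rational_fps_mult:
  assumes "F \<in> rational_fps K" "G \<in> rational_fps K"
  shows "F * G \<in> rational_fps K"
proof -
  obtain p d where 1: "\<And>n. poly.coeff p n \<in> K" "\<And>n. poly.coeff d n \<in> K" "poly.coeff d 0 \<noteq> 0"
    and F: "F * fps_of_poly d = fps_of_poly p" using assms(1) by (rule rational_fpsE) blast
  obtain p' d' where 2: "\<And>n. poly.coeff p' n \<in> K" "\<And>n. poly.coeff d' n \<in> K" "poly.coeff d' 0 \<noteq> 0"
    and G: "G * fps_of_poly d' = fps_of_poly p'" using assms(2) by (rule rational_fpsE) blast
  have "(F * G) * fps_of_poly (d * d') = fps_of_poly (p * p')"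
    by (simp add: fps_of_poly_mult algebra_simps flip: F G)
  then show ?thesis
    using 1 2 by (intro rational_fpsI[of "p * p'" "d * d'"])
      (auto simp: coeff_mult_0 intro!: poly_mult_coeffs_in)
qed

lemma rational_fps_sum:
  "(\<And>i. i \<in> I \<Longrightarrow> F i \<in> rational_fps K) \<Longrightarrow> (\<Sum>i\<in>I. F i) \<in> rational_fps K"
  using rational_fps_const[OF zero_in]
  by (induction I rule: infinite_finite_induct) (auto intro: rational_fps_add)

lemma rational_fps_divide_linear:
  assumes "F * (1 - fps_const c * fps_X) \<in> rational_fps K" and "c \<in> K"
  shows "F \<in> rational_fps K"
proof -
  obtain p d where *: "\<And>n. poly.coeff p n \<in> K" "\<And>n. poly.coeff d n \<in> K" "poly.coeff d 0 \<noteq> 0"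
    and F: "F * (1 - fps_const c * fps_X) * fps_of_poly d = fps_of_poly p"
    using assms(1) by (rule rational_fpsE) blast
  have "F * fps_of_poly ([:1, - c:] * d) = fps_of_poly p"
    by (simp only: fps_of_poly_mult fps_of_poly_linear' flip: F fps_const_neg) (simp add: mult.assoc)
  moreover have "poly.coeff [:1, - c:] n \<in> K" for n
    using assms(2) by (auto simp: coeff_pCons intro: closed split: nat.splits)
  ultimately show ?thesis
    using * by (intro rational_fpsI[of p "[:1, - c:] * d"] poly_mult_coeffs_in) (auto simp: coeff_mult_0)
qed

lemma rational_fps_scale:
  assumes "F \<in> rational_fps K" "c \<in> K"
  shows "F oo (fps_const c * fps_X) \<in> rational_fps K"
proof -
  obtain p d where *: "\<And>n. poly.coeff p n \<in> K" "\<And>n. poly.coeff d n \<in> K" "poly.coeff d 0 \<noteq> 0"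
    and F: "F * fps_of_poly d = fps_of_poly p" using assms(1) by (rule rational_fpsE) blast
  have scale: "fps_of_poly p oo (fps_const c * fps_X) = fps_of_poly (pcompose p [:0, c:])" for p
    by (simp add: fps_eq_iff fps_compose_linear coeff_pcompose_linear)
  have "(F oo (fps_const c * fps_X)) * (fps_of_poly d oo (fps_const c * fps_X))
      = fps_of_poly p oo (fps_const c * fps_X)"
    by (simp add: fps_compose_mult_distrib flip: F)
  then show ?thesis
    using * assms(2) unfolding scale
    by (intro rational_fpsI[of "pcompose p [:0, c:]" "pcompose d [:0, c:]"])
      (auto simp: coeff_pcompose_linear poly_0_coeff_0 intro: closed)
qed

end

section \<open>Products over geometric progressions\<close>

text \<open>
  The series \<open>W\<^sub>N(w)\<close> with zeros at the reciprocals of \<open>a j / q\<^sup>t\<close> for \<open>t < N\<close> and poles at those of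
  \<open>b j / q\<^sup>t\<close> for \<open>t \<le> N\<close>; the poles run over one more value of \<open>t\<close> than the zeros.
\<close>

definition grid_ratio :: "complex \<Rightarrow> 'j set \<Rightarrow> ('j \<Rightarrow> complex) \<Rightarrow> ('j \<Rightarrow> complex) \<Rightarrow> nat \<Rightarrow> complex fps" where
  "grid_ratio q S a b N =
     linear_ratio (S \<times> {..<N}) (\<lambda>(j, t). a j / q ^ t) (S \<times> {..N}) (\<lambda>(j, t). b j / q ^ t)"

text \<open>
  Substituting \<open>w/q\<close> shifts every \<open>t\<close> to \<open>t + 1\<close>, so only the factors with \<open>t = 0\<close> remain to be
  supplied. Splitting off the factors with the largest \<open>t\<close> instead would put powers of \<open>q\<^sup>-\<^sup>N\<close> into
  the coefficients of the recurrence.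
\<close>

lemma grid_ratio_Suc:
  "grid_ratio q S a b (Suc N) =
     linear_ratio S a S b * (grid_ratio q S a b N oo (fps_const (1 / q) * fps_X))"
proof -
  define L where "L c = 1 - fps_const c * fps_X" for c :: complex
  let ?G = "\<lambda>c T. \<Prod>(j, t)\<in>S \<times> T. L (c j / q ^ t)"
  have scale: "L (c / q ^ t) oo (fps_const (1 / q) * fps_X) = L (c / q ^ Suc t)" for c t
    by (auto simp: L_def fps_eq_iff fps_compose_linear le_Suc_eq)
  have scaleG: "?G c {..<M} oo (fps_const (1 / q) * fps_X) = (\<Prod>j\<in>S. \<Prod>t<M. L (c j / q ^ Suc t))" for c M
    by (subst fps_compose_prod_distrib) (auto simp: scale prod.cartesian_product case_prod_unfold)
  have shift: "?G c {..<Suc M} = (\<Prod>j\<in>S. L (c j)) * (?G c {..<M} oo (fps_const (1 / q) * fps_X))" for c M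
    by (subst scaleG, subst prod.cartesian_product[symmetric], subst prod.lessThan_Suc_shift)
      (simp add: prod.distrib)
  have ratio: "grid_ratio q S a b M = ?G a {..<M} * inverse (?G b {..<Suc M})" for M
    by (simp add: grid_ratio_def linear_ratio_def L_def case_prod_unfold lessThan_Suc_atMost)
  have nz: "fps_nth (?G c T) 0 \<noteq> 0" for c T
    by (simp add: fps_prod_nth_0 L_def case_prod_unfold)
  let ?z = "fps_const (1 / q) * fps_X"
  have "grid_ratio q S a b (Suc N) = (\<Prod>j\<in>S. L (a j)) * (?G a {..<N} oo ?z) *
      inverse ((\<Prod>j\<in>S. L (b j)) * (?G b {..<Suc N} oo ?z))"
    by (simp only: ratio shift[of _ N] shift[of _ "Suc N"])
  also have "\<dots> = (\<Prod>j\<in>S. L (a j)) * inverse (\<Prod>j\<in>S. L (b j)) *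
      ((?G a {..<N} oo ?z) * inverse (?G b {..<Suc N} oo ?z))"
    by (simp only: fps_inverse_mult mult_ac)
  also have "inverse (?G b {..<Suc N} oo ?z) = inverse (?G b {..<Suc N}) oo ?z"
    by (intro fps_inverse_compose[symmetric] nz) simp
  also have "(?G a {..<N} oo ?z) * (inverse (?G b {..<Suc N}) oo ?z) = grid_ratio q S a b N oo ?z"
    unfolding ratio by (intro fps_compose_mult_distrib[symmetric]) simp
  finally show ?thesis by (simp only: linear_ratio_def L_def)
qed

lemma (in complex_subring) grid_ratio_generating_function_rational:
  assumes "1 / q \<in> K" and "\<And>j. j \<in> S \<Longrightarrow> a j \<in> K" and "\<And>j. j \<in> S \<Longrightarrow> b j \<in> K"
  shows "Abs_fps (\<lambda>N. fps_nth (grid_ratio q S a b N) e) \<in> rational_fps K"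
proof (induction e rule: less_induct)
  case (less e)
  define Y where "Y e = Abs_fps (\<lambda>N. fps_nth (grid_ratio q S a b N) e)" for e
  define R where "R = linear_ratio S a S b"
  have R: "fps_nth R n \<in> K" for n
    unfolding R_def using assms by (intro linear_ratio_coeffs_in)
  have R0: "fps_nth R 0 = 1" by (simp add: R_def linear_ratio_def fps_prod_nth_0)
  have init: "fps_nth (grid_ratio q S a b 0) e \<in> K"
    unfolding grid_ratio_def using assms by (intro linear_ratio_coeffs_in) auto
  have rec: "fps_nth (grid_ratio q S a b (Suc N)) e =
      (1 / q) ^ e * fps_nth (grid_ratio q S a b N) e
      + (\<Sum>d<e. fps_nth R (e - d) * (1 / q) ^ d * fps_nth (grid_ratio q S a b N) d)" for N
  proof -
    have "fps_nth (grid_ratio q S a b (Suc N)) e =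
       (\<Sum>d\<le>e. fps_nth R (e - d) * ((1 / q) ^ d * fps_nth (grid_ratio q S a b N) d))"
      unfolding grid_ratio_Suc R_def[symmetric]
      by (subst mult.commute) (simp add: fps_mult_nth fps_compose_linear atLeast0AtMost mult.commute[of "fps_nth R _"])
    also have "{..e} = insert e {..<e}" by auto
    finally show ?thesis by (simp add: R0 mult.assoc)
  qed
  \<comment> \<open>The term \<open>d = e\<close> of the recurrence has coefficient \<open>q\<^sup>-\<^sup>e\<close> and is moved to the left-hand side.\<close>
  have "Y e * (1 - fps_const ((1 / q) ^ e) * fps_X) =
     fps_const (fps_nth (grid_ratio q S a b 0) e)
     + fps_X * (\<Sum>d<e. fps_const (fps_nth R (e - d) * (1 / q) ^ d) * Y d)"
  proof (rule fps_ext)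
    fix n
    show "fps_nth (Y e * (1 - fps_const ((1 / q) ^ e) * fps_X)) n = fps_nth (
     fps_const (fps_nth (grid_ratio q S a b 0) e)
     + fps_X * (\<Sum>d<e. fps_const (fps_nth R (e - d) * (1 / q) ^ d) * Y d)) n"
    proof (cases n)
      case 0
      then show ?thesis by (simp add: Y_def)
    next
      case (Suc N)
      have "fps_nth (Y e * (1 - fps_const ((1 / q) ^ e) * fps_X)) (Suc N)
         = fps_nth (Y e) (Suc N) - (1 / q) ^ e * fps_nth (Y e) N"
        by (simp add: algebra_simps)
      then show ?thesis unfolding Suc by (simp add: Y_def rec fps_sum_nth)
    qed
  qed
  moreover have "\<dots> \<in> rational_fps K"
    using less R assms(1) unfolding Y_def
    by (intro rational_fps_add rational_fps_mult rational_fps_sum rational_fps_const rational_fps_X init)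
      (auto intro: closed)
  ultimately have "Y e \<in> rational_fps K"
    using assms(1) by (intro rational_fps_divide_linear[of "Y e" "(1 / q) ^ e"]) (auto intro: closed)
  then show ?case by (simp add: Y_def)
qed

section \<open>The coefficient field\<close>

lemma H_field_subring: "complex_subring (H_field q r a b)"
proof
  note [simp] = ring_of_type_algebra_def
  note defs = H_field_def
  show "1 \<in> H_field q r a b" unfolding defs using generate_field.one[of ring_of_type_algebra] by simp
  show "x + y \<in> H_field q r a b" if "x \<in> H_field q r a b" "y \<in> H_field q r a b" for x y
    using generate_field.eng_add[OF that[unfolded defs]] by (simp add: defs)
  show "x * y \<in> H_field q r a b" if "x \<in> H_field q r a b" "y \<in> H_field q r a b" for x y
    using generate_field.eng_mult[OF that[unfolded defs]] by (simp add: defs)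
  show "- x \<in> H_field q r a b" if "x \<in> H_field q r a b" for x
  proof -
    have "abelian_group (ring_of_type_algebra :: complex ring)"
      using ring_from_type_algebra ring.is_abelian_group by blast
    then have "\<ominus>\<^bsub>ring_of_type_algebra\<^esub> x = - x"
      by (intro abelian_group.minus_equality) auto
    then show ?thesis using generate_field.a_inv[OF that[unfolded defs]] by (simp add: defs)
  qed
qed

lemma H_field_inverse:
  assumes "x \<in> H_field q r a b" "x \<noteq> 0"
  shows "1 / x \<in> H_field q r a b"
proof -
  have "comm_monoid (ring_of_type_algebra :: complex ring)"
    using cring_from_type_algebra cring.axioms(2) by blast
  then have "inv\<^bsub>ring_of_type_algebra\<^esub> x = 1 / x"
    using assms(2) by (intro comm_monoid.comm_inv_char) (auto simp: ring_of_type_algebra_def)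
  then show ?thesis
    using generate_field.m_inv[OF assms(1)[unfolded H_field_def]] assms(2)
    by (simp add: H_field_def ring_of_type_algebra_def)
qed

lemma H_field_generators:
  "q \<in> H_field q r a b"
  "j \<in> {1..r} \<Longrightarrow> a j \<in> H_field q r a b"
  "j \<in> {1..r} \<Longrightarrow> b j \<in> H_field q r a b"
  unfolding H_field_def by (auto intro: generate_field.incl)

section \<open>Hypergeometric coefficients as residues\<close>

text \<open>
  The factors with \<open>t < n\<close> form the first \<open>q\<close>-shifted factorial, taken in reverse order, and those
  with \<open>t \<ge> n\<close> the second. The remaining monomials are left as a product because those of numerators
  and denominators cancel.
\<close>

lemma prod_q_grid:
  assumes "q \<noteq> 0" "b \<noteq> 0" "a \<noteq> 0"
  shows "(\<Prod>t<n+m. b / q ^ n - a / q ^ t) =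
    (b / q ^ n) ^ n * qpochhammer (q * a / b) q n * ((\<Prod>t<m. - a / q ^ (n + t)) * qpochhammer (b / a) q m)"
proof -
  have low: "(\<Prod>t<n. b / q ^ n - a / q ^ t) = (b / q ^ n) ^ n * qpochhammer (q * a / b) q n"
  proof -
    have "(\<Prod>t<n. b / q ^ n - a / q ^ t) = (\<Prod>t<n. b / q ^ n - a / q ^ (n - Suc t))"
      by (rule prod.nat_diff_reindex[symmetric])
    also have "\<dots> = (\<Prod>t<n. b / q ^ n * (1 - q * a / b * q ^ t))"
    proof (rule prod.cong)
      fix t assume "t \<in> {..<n}"
      then have "q ^ n = q ^ (n - Suc t + Suc t)" by simp
      then have "q ^ n = q ^ (n - Suc t) * q ^ Suc t" by (simp only: power_add)
      then show "b / q ^ n - a / q ^ (n - Suc t) = b / q ^ n * (1 - q * a / b * q ^ t)"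
        using assms by (simp add: field_simps)
    qed simp
    also have "\<dots> = (b / q ^ n) ^ n * qpochhammer (q * a / b) q n"
      unfolding qpochhammer_def by (simp only: prod.distrib prod_constant card_lessThan)
    finally show ?thesis .
  qed
  have high: "(\<Prod>t=n..<n+m. b / q ^ n - a / q ^ t) = (\<Prod>t<m. - a / q ^ (n + t)) * qpochhammer (b / a) q m"
  proof -
    have "(\<Prod>t=n..<n+m. b / q ^ n - a / q ^ t) = (\<Prod>t<m. b / q ^ n - a / q ^ (n + t))"
      using prod.shift_bounds_nat_ivl[of "\<lambda>t. b / q ^ n - a / q ^ t" 0 n m]
      by (simp add: lessThan_atLeast0 add.commute)
    also have "\<dots> = (\<Prod>t<m. - a / q ^ (n + t) * (1 - b / a * q ^ t))"
      using assms by (intro prod.cong) (auto simp: field_simps power_add)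
    also have "\<dots> = (\<Prod>t<m. - a / q ^ (n + t)) * qpochhammer (b / a) q m"
      unfolding qpochhammer_def by (simp only: prod.distrib)
    finally show ?thesis .
  qed
  have split: "{..<n+m} = {..<n} \<union> {n..<n+m}" by auto
  have "(\<Prod>t<n+m. b / q ^ n - a / q ^ t) =
      (\<Prod>t<n. b / q ^ n - a / q ^ t) * (\<Prod>t=n..<n+m. b / q ^ n - a / q ^ t)"
    unfolding split by (rule prod.union_disjoint) auto
  then show ?thesis unfolding low high .
qed

lemma prod_q_grid_punctured:
  assumes "q \<noteq> 0" "b \<noteq> 0" "c \<noteq> 0"
  shows "(\<Prod>t\<in>{..n+m}-{n}. b / q ^ n - c / q ^ t) =
    (b / q ^ n) ^ n * qpochhammer (q * c / b) q n *
      ((\<Prod>t<m. - c / q ^ (n + t)) / q ^ m * qpochhammer (q * b / c) q m)"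
proof -
  have low: "(\<Prod>t<n. b / q ^ n - c / q ^ t) = (b / q ^ n) ^ n * qpochhammer (q * c / b) q n"
    using prod_q_grid[OF assms, of n 0] by (simp add: qpochhammer_def)
  have high: "(\<Prod>t=Suc n..n+m. b / q ^ n - c / q ^ t) =
     (\<Prod>t<m. - c / q ^ (n + t)) / q ^ m * qpochhammer (q * b / c) q m"
  proof -
    have "(\<Prod>t=Suc n..n+m. b / q ^ n - c / q ^ t) = (\<Prod>t<m. b / q ^ n - c / q ^ (Suc n + t))"
      using prod.shift_bounds_nat_ivl[of "\<lambda>t. b / q ^ n - c / q ^ t" 0 "Suc n" m]
      by (simp add: lessThan_atLeast0 add.commute flip: atLeastLessThanSuc_atLeastAtMost)
    also have "\<dots> = (\<Prod>t<m. - c / q ^ (n + t) / q * (1 - q * b / c * q ^ t))"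
      using assms by (intro prod.cong) (auto simp: field_simps power_add)
    also have "\<dots> = (\<Prod>t<m. - c / q ^ (n + t)) / q ^ m * qpochhammer (q * b / c) q m"
      unfolding qpochhammer_def by (simp only: prod.distrib prod_dividef prod_constant card_lessThan)
    finally show ?thesis .
  qed
  have split: "{..n+m} - {n} = {..<n} \<union> {Suc n..n+m}" by auto
  have "(\<Prod>t\<in>{..n+m}-{n}. b / q ^ n - c / q ^ t) =
      (\<Prod>t<n. b / q ^ n - c / q ^ t) * (\<Prod>t=Suc n..n+m. b / q ^ n - c / q ^ t)"
    unfolding split by (rule prod.union_disjoint) auto
  then show ?thesis unfolding low high .
qed

text \<open>The poles \<open>b\<^sub>j / q\<^sup>t\<close>, and with \<open>a\<close> in place of \<open>b\<close> the zeros, indexed by the pairs \<open>(j, t)\<close>.\<close>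

abbreviation q_grid :: "complex \<Rightarrow> (nat \<Rightarrow> complex) \<Rightarrow> nat \<times> nat \<Rightarrow> complex" where
  "q_grid q b \<equiv> (\<lambda>(j, t). b j / q ^ t)"

text \<open>
  The normalisation \<open>b\<^sub>r = q\<close> enters here: it turns the argument \<open>a\<^sub>1 \<cdots> a\<^sub>r q\<^sup>r\<^sup>-\<^sup>2 z / (b\<^sub>1 \<cdots> b\<^sub>r\<^sub>-\<^sub>1)\<close> of \<open>g\<^sub>i\<close>
  into \<open>a\<^sub>1 \<cdots> a\<^sub>r q\<^sup>r\<^sup>-\<^sup>1 z / (b\<^sub>1 \<cdots> b\<^sub>r)\<close>.
\<close>

lemma f_g_coeff_eq_residue_weight:
  assumes r: "r \<ge> 2" and q: "q \<noteq> 0" and i: "i \<in> {1..r}"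
    and a0: "\<And>j. j \<in> {1..r} \<Longrightarrow> a j \<noteq> 0" and b0: "\<And>j. j \<in> {1..r} \<Longrightarrow> b j \<noteq> 0" and br: "b r = q"
  shows "c_coeff q r b i * fps_nth (f_series q r a b i) n * fps_nth (g_series q r a b i) m =
    q / q ^ (n + m) *
     (residue_weight ({1..r} \<times> {..n+m}) (q_grid q b) ({1..r} \<times> {..<n+m}) (q_grid q a) (i, n)
        * (b i / q ^ n) ^ (r - 2))"
proof -
  define num where "num j = (\<Prod>t<n+m. b i / q ^ n - a j / q ^ t)" for j
  define den where "den j = (\<Prod>t\<in>{..n+m}-{n}. b i / q ^ n - b j / q ^ t)" for j
  define U where "U j = qpochhammer (q * a j / b i) q n / qpochhammer (q * b j / b i) q n" for j
  define V where "V j = qpochhammer (b i / a j) q m / qpochhammer (q * b i / b j) q m" for j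
  define D where "D = (\<Prod>j\<in>{1..r}-{i}. b i - b j)"
  obtain s where s: "r = Suc (Suc s)" using r by (metis add_2_eq_Suc le_Suc_ex)
  have bi: "b i \<noteq> 0" using b0 i by blast
  have quot: "num j / den j = U j * V j * (a j * q / b j) ^ m" if j: "j \<in> {1..r}" for j
  proof -
    have nz: "(b i / q ^ n) ^ n \<noteq> 0" "(\<Prod>t<m. 1 / q ^ (n + t)) \<noteq> 0" using bi q by simp_all
    have E: "(\<Prod>t<m. - c / q ^ (n + t)) = (- c) ^ m * (\<Prod>t<m. 1 / q ^ (n + t))" for c
    proof -
      have "(\<Prod>t<m. - c / q ^ (n + t)) = (\<Prod>t<m. - c * (1 / q ^ (n + t)))" by simp
      then show ?thesis by (simp only: prod.distrib prod_constant card_lessThan)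
    qed
    have cancel: "P * u * (x * E * v) / (P * u' * (y * E / z * v')) = u / u' * (v / v') * (x / (y / z))"
      if "P \<noteq> 0" "E \<noteq> 0" for P E u u' v v' x y z :: complex
    proof -
      have "P * u * (x * E * v) / (P * u' * (y * E / z * v')) = (P * E) * (u * v * x) / ((P * E) * (u' * v' * (y / z)))"
        by (simp add: mult_ac)
      also have "\<dots> = u * v * x / (u' * v' * (y / z))"
        using that by (intro mult_divide_mult_cancel_left) simp
      finally show ?thesis by (simp add: mult.assoc)
    qed
    have "(- a j) ^ m / ((- b j) ^ m / q ^ m) = (a j * q / b j) ^ m"
      by (simp add: power_mult_distrib power_divide power_minus[of "a j"] power_minus[of "b j"])
    moreover have "num j / den j = U j * V j * ((- a j) ^ m / ((- b j) ^ m / q ^ m))"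
      unfolding num_def den_def prod_q_grid[OF q bi a0[OF j]] prod_q_grid_punctured[OF q bi b0[OF j]] E U_def V_def
      by (rule cancel[OF nz])
    ultimately show ?thesis by simp
  qed
  have "residue_weight ({1..r} \<times> {..n+m}) (q_grid q b) ({1..r} \<times> {..<n+m}) (q_grid q a) (i, n)
     = (\<Prod>j=1..r. num j) / (D / q ^ (n * (r - 1)) * (\<Prod>j=1..r. den j))"
  proof -
    \<comment> \<open>The poles other than \<open>b i / q ^ n\<close> are those with the same \<open>t = n\<close> and those with \<open>t \<noteq> n\<close>.\<close>
    have split: "{1..r} \<times> {..n+m} - {(i, n)} = (\<lambda>j. (j, n)) ` ({1..r} - {i}) \<union> {1..r} \<times> ({..n+m} - {n})"
      using i by auto
    have "(\<Prod>p\<in>{1..r} \<times> {..n+m} - {(i, n)}. b i / q ^ n - q_grid q b p)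
      = (\<Prod>p\<in>(\<lambda>j. (j, n)) ` ({1..r} - {i}). b i / q ^ n - q_grid q b p) *
        (\<Prod>p\<in>{1..r} \<times> ({..n+m} - {n}). b i / q ^ n - q_grid q b p)"
      unfolding split by (rule prod.union_disjoint) auto
    also have "(\<Prod>p\<in>(\<lambda>j. (j, n)) ` ({1..r} - {i}). b i / q ^ n - q_grid q b p)
      = (\<Prod>j\<in>{1..r}-{i}. (b i - b j) / q ^ n)"
      by (subst prod.reindex) (auto simp: inj_on_def diff_divide_distrib)
    also have "\<dots> = D / q ^ (n * (r - 1))"
      using i by (simp add: D_def prod_dividef power_mult)
    also have "(\<Prod>p\<in>{1..r} \<times> ({..n+m} - {n}). b i / q ^ n - q_grid q b p) = (\<Prod>j=1..r. den j)"
      by (simp add: den_def prod.cartesian_product case_prod_unfold)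
    finally show ?thesis
      by (simp add: residue_weight_def num_def prod.cartesian_product case_prod_unfold)
  qed
  also have "\<dots> = (\<Prod>j=1..r. num j / den j) * q ^ (n * (r - 1)) / D"
    by (simp add: prod_dividef)
  also have "(\<Prod>j=1..r. num j / den j) = (\<Prod>j=1..r. U j) * (\<Prod>j=1..r. V j) * ((\<Prod>j=1..r. a j) * q ^ r / (\<Prod>j=1..r. b j)) ^ m"
  proof -
    have "(\<Prod>j=1..r. num j / den j) = (\<Prod>j=1..r. U j * V j * (a j * q / b j) ^ m)"
      using quot by (intro prod.cong) auto
    also have "\<dots> = (\<Prod>j=1..r. U j) * (\<Prod>j=1..r. V j) * (\<Prod>j=1..r. a j * q / b j) ^ m"
      by (simp only: prod.distrib prod_power_distrib)
    also have "(\<Prod>j=1..r. a j * q / b j) = (\<Prod>j=1..r. a j) * q ^ r / (\<Prod>j=1..r. b j)"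
      by (simp add: prod.distrib prod_dividef)
    finally show ?thesis .
  qed
  finally have w: "residue_weight ({1..r} \<times> {..n+m}) (q_grid q b) ({1..r} \<times> {..<n+m}) (q_grid q a) (i, n)
     = (\<Prod>j=1..r. U j) * (\<Prod>j=1..r. V j) * ((\<Prod>j=1..r. a j) * q ^ r / (\<Prod>j=1..r. b j)) ^ m * q ^ (n * (r - 1)) / D" .
  have B: "(\<Prod>j=1..r. b j) = (\<Prod>j=1..r-1. b j) * q"
    using s br by simp
  have f: "fps_nth (f_series q r a b i) n = (\<Prod>j=1..r. U j)"
    by (simp add: f_series_def U_def prod_dividef)
  have g: "fps_nth (g_series q r a b i) m = (\<Prod>j=1..r. V j) * ((\<Prod>j=1..r. a j) * q ^ (r - 1) / (\<Prod>j=1..r. b j)) ^ m"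
  proof -
    have "A * q ^ (r - 1) / (P * q) = A * q ^ (r - 2) / P" for A P
      using q s by simp
    then show ?thesis unfolding B by (simp add: g_series_def V_def prod_dividef)
  qed
  have c: "c_coeff q r b i = q * b i ^ (r - 2) / D"
    by (simp add: c_coeff_def D_def prod_dividef)
  have "q ^ m * (A * q ^ (r - 1)) ^ m = (A * q ^ r) ^ m" for A
    using s by (simp add: power_mult_distrib flip: power_mult power_add)
  then have 1: "((\<Prod>j=1..r. a j) * q ^ r / (\<Prod>j=1..r. b j)) ^ m = q ^ m * ((\<Prod>j=1..r. a j) * q ^ (r - 1) / (\<Prod>j=1..r. b j)) ^ m"
    by (simp add: power_divide)
  have 2: "q ^ (n * (r - 1)) * (b i / q ^ n) ^ (r - 2) = q ^ n * b i ^ (r - 2)"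
    using s q by (simp add: power_divide power_add flip: power_mult)
  have rearrange: "q * g / D * u * (v * y) = q / q ^ (n + m) * (u * v * (q ^ m * y) * p / D * w)"
    if "p * w = q ^ n * g" for g u v y p w
  proof -
    have "q / q ^ (n + m) * (u * v * (q ^ m * y) * p / D * w)
        = q / q ^ (n + m) * (u * v * (q ^ m * y) / D * (p * w))"
      by (simp only: divide_inverse mult_ac)
    also have "\<dots> = q * g / D * u * (v * y) * (q ^ n / q ^ n) * (q ^ m / q ^ m)"
      unfolding that power_add by (simp only: divide_inverse inverse_mult_distrib mult_ac)
    finally have "q / q ^ (n + m) * (u * v * (q ^ m * y) * p / D * w)
        = q * g / D * u * (v * y) * (q ^ n / q ^ n) * (q ^ m / q ^ m)" .
    moreover have "q ^ n / q ^ n = 1" "q ^ m / q ^ m = 1" using q by simp_all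
    ultimately show ?thesis by (simp only: mult_1_right)
  qed
  show ?thesis unfolding w f g c 1 by (rule rearrange[OF 2])
qed

text \<open>
  The entry \<open>M\<^sub>k\<^sub>l\<close> as a power series, the solutions \<open>h i\<close> of \<open>h(qz) = (q / b\<^sub>i) h(z)\<close> having been
  cancelled against their inverses.
\<close>

definition M_series :: "complex \<Rightarrow> nat \<Rightarrow> (nat \<Rightarrow> complex) \<Rightarrow> (nat \<Rightarrow> complex) \<Rightarrow> nat \<Rightarrow> nat \<Rightarrow> complex fps" where
  "M_series q r a b k l = (\<Sum>i=1..r. fps_const (c_coeff q r b i * (q / b i) ^ k * (b i / q) ^ l)
     * (f_series q r a b i oo (fps_const (q ^ k) * fps_X))
     * (g_series q r a b i oo (fps_const (q ^ l) * fps_X)))"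

text \<open>
  The coefficient of \<open>z\<^sup>N\<close> as a sum over all poles \<open>x\<close>. The exponent \<open>r - 2 - k + l\<close> of \<open>x\<close> is kept in
  three factors, since it equals \<open>-1\<close> when \<open>(k, l) = (r - 1, 0)\<close>.
\<close>

lemma M_series_nth:
  assumes "r \<ge> 2" "q \<noteq> 0"
    and "\<And>j. j \<in> {1..r} \<Longrightarrow> a j \<noteq> 0" and b0: "\<And>j. j \<in> {1..r} \<Longrightarrow> b j \<noteq> 0" and "b r = q"
  shows "fps_nth (M_series q r a b k l) N = q * (q ^ l / q) ^ N *
    (\<Sum>p\<in>{1..r} \<times> {..N}. residue_weight ({1..r} \<times> {..N}) (q_grid q b) ({1..r} \<times> {..<N}) (q_grid q a) p
        * (q_grid q b p ^ (r - 2) * (q / q_grid q b p) ^ k * (q_grid q b p / q) ^ l))"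
proof -
  let ?w = "residue_weight ({1..r} \<times> {..N}) (q_grid q b) ({1..r} \<times> {..<N}) (q_grid q a)"
  have "fps_nth (M_series q r a b k l) N = (\<Sum>i=1..r. \<Sum>n\<le>N. c_coeff q r b i * (q / b i) ^ k * (b i / q) ^ l *
    ((q ^ k) ^ n * fps_nth (f_series q r a b i) n * ((q ^ l) ^ (N - n) * fps_nth (g_series q r a b i) (N - n))))"
    by (simp only: M_series_def fps_sum_nth mult.assoc fps_mult_left_const_nth)
      (simp add: fps_mult_nth fps_compose_linear sum_distrib_left mult.assoc atLeast0AtMost)
  also have "\<dots> = (\<Sum>i=1..r. \<Sum>n\<le>N. q * (q ^ l / q) ^ N *
      (?w (i, n) * ((b i / q ^ n) ^ (r - 2) * (q / (b i / q ^ n)) ^ k * ((b i / q ^ n) / q) ^ l)))"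
  proof (intro sum.cong refl)
    fix i n assume i: "i \<in> {1..r}" and n: "n \<in> {..N}"
    then obtain m where m: "N = n + m" by (auto simp: le_iff_add)
    have eq: "c_coeff q r b i * fps_nth (f_series q r a b i) n * fps_nth (g_series q r a b i) (N - n)
       = q / q ^ N * (?w (i, n) * (b i / q ^ n) ^ (r - 2))"
      using f_g_coeff_eq_residue_weight[of r q i a b n m] assms i m by simp
    have pw: "(q / b i) ^ k * (q ^ k) ^ n = (q / (b i / q ^ n)) ^ k"
       "(b i / q) ^ l * (q ^ l) ^ (N - n) = (q ^ l) ^ N * ((b i / q ^ n) / q) ^ l"
      using assms(2) m by (simp_all add: power_divide power_mult_distrib power_add mult.commute[of n] mult.commute[of m] flip: power_mult)
    have "c_coeff q r b i * (q / b i) ^ k * (b i / q) ^ l *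
    ((q ^ k) ^ n * fps_nth (f_series q r a b i) n * ((q ^ l) ^ (N - n) * fps_nth (g_series q r a b i) (N - n)))
     = (c_coeff q r b i * fps_nth (f_series q r a b i) n * fps_nth (g_series q r a b i) (N - n)) *
       ((q / b i) ^ k * (q ^ k) ^ n) * ((b i / q) ^ l * (q ^ l) ^ (N - n))"
      by (simp add: mult_ac)
    also have "\<dots> = q * (q ^ l / q) ^ N *
      (?w (i, n) * ((b i / q ^ n) ^ (r - 2) * (q / (b i / q ^ n)) ^ k * ((b i / q ^ n) / q) ^ l))"
      unfolding eq pw by (simp add: power_divide mult_ac)
    finally show "c_coeff q r b i * (q / b i) ^ k * (b i / q) ^ l *
    ((q ^ k) ^ n * fps_nth (f_series q r a b i) n * ((q ^ l) ^ (N - n) * fps_nth (g_series q r a b i) (N - n)))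
     = q * (q ^ l / q) ^ N *
      (?w (i, n) * ((b i / q ^ n) ^ (r - 2) * (q / (b i / q ^ n)) ^ k * ((b i / q ^ n) / q) ^ l))" .
  qed
  also have "\<dots> = q * (q ^ l / q) ^ N *
    (\<Sum>p\<in>{1..r} \<times> {..N}. ?w p * (q_grid q b p ^ (r - 2) * (q / q_grid q b p) ^ k * (q_grid q b p / q) ^ l))"
    by (simp add: sum_distrib_left sum.cartesian_product case_prod_unfold)
  finally show ?thesis .
qed

section \<open>Eigenvectors of the shift operator\<close>

lemma (in q_difference_extension) \<iota>_zero: "\<iota> 0 = 0"
  using \<iota>_add[of 0 0] by simp

lemma (in q_difference_extension) \<iota>_sum: "\<iota> (\<Sum>i\<in>I. F i) = (\<Sum>i\<in>I. \<iota> (F i))"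
  by (induction I rule: infinite_finite_induct) (auto simp: \<iota>_zero \<iota>_add)

lemma (in q_difference_extension) \<sigma>_pow_eigenvector:
  assumes "\<sigma> u = \<iota> (fps_const c) * u"
  shows "(\<sigma> ^^ k) (u * \<iota> F) = \<iota> (fps_const (c ^ k) * (F oo (fps_const (q ^ k) * fps_X))) * u"
proof (induction k)
  case 0
  then show ?case by (simp add: \<iota>_mult \<iota>_one)
next
  case (Suc k)
  have *: "(fps_const (c ^ k) * (F oo (fps_const (q ^ k) * fps_X))) oo (fps_const q * fps_X)
      = fps_const (c ^ k) * (F oo (fps_const (q ^ Suc k) * fps_X))"
    by (simp add: fps_eq_iff fps_compose_linear power_mult_distrib)
  have "(\<sigma> ^^ Suc k) (u * \<iota> F) =
      \<iota> (fps_const (c ^ k) * (F oo (fps_const (q ^ Suc k) * fps_X))) * (\<iota> (fps_const c) * u)"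
    using Suc by (simp only: funpow.simps comp_def \<sigma>_mult \<sigma>_\<iota> * assms)
  also have "\<dots> = \<iota> (fps_const (c ^ Suc k) * (F oo (fps_const (q ^ Suc k) * fps_X))) * u"
    by (simp add: \<iota>_mult mult_ac flip: fps_const_mult)
  finally show ?case .
qed

lemma (in q_difference_extension) \<sigma>_inverse_eigenvector:
  assumes "\<sigma> u = \<iota> (fps_const c) * u" "u * v = 1" "c \<noteq> 0"
  shows "\<sigma> v = \<iota> (fps_const (1 / c)) * v"
proof -
  have c: "\<iota> (fps_const c) * \<iota> (fps_const (1 / c)) = 1"
    using assms(3) by (simp flip: \<iota>_mult) (simp add: \<iota>_one)
  have "\<iota> (fps_const c) * u * \<sigma> v = 1"
    using \<sigma>_mult[of u v] assms by (simp add: \<sigma>_one)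
  then have "(\<iota> (fps_const (1 / c)) * v) * (\<iota> (fps_const c) * u * \<sigma> v) = \<iota> (fps_const (1 / c)) * v"
    by simp
  moreover have "(\<iota> (fps_const (1 / c)) * v) * (\<iota> (fps_const c) * u * \<sigma> v)
      = (\<iota> (fps_const c) * \<iota> (fps_const (1 / c))) * (u * v) * \<sigma> v" by (simp add: mult_ac)
  ultimately show ?thesis using c assms(2) by simp
qed

lemma (in q_difference_extension) M_entry_eq_M_series:
  assumes "q \<noteq> 0" and "\<And>i. i \<in> {1..r} \<Longrightarrow> b i \<noteq> 0"
    and h: "\<And>i. i \<in> {1..r} \<Longrightarrow> \<sigma> (h i) = \<iota> (fps_const (q / b i)) * h i"
    and h': "\<And>i. i \<in> {1..r} \<Longrightarrow> h i * h' i = 1"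
  shows "M_entry q r a b \<iota> \<sigma> h h' k l = \<iota> (M_series q r a b k l)"
  unfolding M_entry_def M_series_def \<iota>_sum
proof (rule sum.cong)
  fix i assume i: "i \<in> {1..r}"
  have "\<sigma> (h' i) = \<iota> (fps_const (b i / q)) * h' i"
    using \<sigma>_inverse_eigenvector[OF h[OF i] h'[OF i]] assms i by simp
  note 1 = \<sigma>_pow_eigenvector[OF h[OF i]] \<sigma>_pow_eigenvector[OF this]
  have "\<iota> C * (\<iota> (F) * h i) * (\<iota> (G) * h' i) = \<iota> (C * F * G) * (h i * h' i)" for C F G
    by (simp add: \<iota>_mult mult_ac)
  then show "\<iota> (fps_const (c_coeff q r b i)) * (\<sigma> ^^ k) (f_sol q r a b \<iota> h i) * (\<sigma> ^^ l) (g_sol q r a b \<iota> h' i) =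
    \<iota> (fps_const (c_coeff q r b i * (q / b i) ^ k * (b i / q) ^ l)
     * (f_series q r a b i oo (fps_const (q ^ k) * fps_X))
     * (g_series q r a b i oo (fps_const (q ^ l) * fps_X)))"
    unfolding f_sol_def g_sol_def 1
    by (simp only: h'[OF i] mult_1_right mult.assoc flip: fps_const_mult)
      (simp only: mult.left_commute)
qed simp

section \<open>The entries of the matrix\<close>

lemma inj_on_q_grid:
  assumes "0 < norm q" "norm q < 1" and b0: "\<And>j. j \<in> S \<Longrightarrow> b j \<noteq> 0"
    and generic: "\<And>i j m. i \<in> S \<Longrightarrow> j \<in> S \<Longrightarrow> i \<noteq> j \<Longrightarrow> b i / b j \<noteq> q powi (m :: int)"
  shows "inj_on (q_grid q b) (S \<times> T)"
proof (rule inj_onI, clarsimp)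
  fix i j s t assume i: "i \<in> S" and j: "j \<in> S" and eq: "b i / q ^ s = b j / q ^ t"
  have q: "q \<noteq> 0" using assms(1) by auto
  have "b i / b j = q ^ s / q ^ t" using eq q b0[OF i] b0[OF j] by (simp add: field_simps)
  also have "\<dots> = q powi (int s - int t)" using q by (simp add: power_int_diff)
  finally have ij: "i = j" using generic[OF i j] by blast
  then have "norm q ^ s = norm q ^ t" using eq b0[OF j] q by (simp flip: norm_power)
  then have "s = t"
    using power_strict_decreasing[OF _ assms(1,2), of s t] power_strict_decreasing[OF _ assms(1,2), of t s]
    by (cases s t rule: linorder_cases) auto
  with ij show "i = j \<and> s = t" by simp
qed

text \<open>
  Parameters \<open>a\<^sub>j\<close>, \<open>b\<^sub>j\<close> of the basic hypergeometric equation, with \<open>b\<^sub>r = q\<close> and no quotient of two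
  different \<open>b\<^sub>j\<close> an integral power of \<open>q\<close>, so that the poles \<open>b\<^sub>j / q\<^sup>t\<close> are distinct.
\<close>

locale generic_parameters =
  fixes q :: complex and r :: nat and a b :: "nat \<Rightarrow> complex"
  assumes r: "r \<ge> 2" and q0: "0 < norm q" and q1: "norm q < 1"
    and a0: "\<And>j. j \<in> {1..r} \<Longrightarrow> a j \<noteq> 0" and b0: "\<And>j. j \<in> {1..r} \<Longrightarrow> b j \<noteq> 0"
    and br: "b r = q"
    and generic: "\<And>i j m. i \<in> {1..r} \<Longrightarrow> j \<in> {1..r} \<Longrightarrow> i \<noteq> j \<Longrightarrow> b i / b j \<noteq> q powi (m :: int)"
begin

lemma q_nz: "q \<noteq> 0" using q0 by auto

lemma q_grid_nz: "p \<in> {1..r} \<times> T \<Longrightarrow> q_grid q b p \<noteq> 0"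
  using b0 q_nz by auto

lemma inj_grid: "inj_on (q_grid q b) ({1..r} \<times> T)"
  using q0 q1 b0 generic by (rule inj_on_q_grid)

lemma card_grid: "card ({1..r} \<times> {..N::nat}) = Suc (card ({1..r} \<times> {..<N}) + (r - 1))"
  using r by (simp add: card_cartesian_product)

lemma M_series_nth_grid_ratio:
  assumes k: "k \<le> r - 2 + l"
  shows "fps_nth (M_series q r a b k l) N =
    q * q ^ k / q ^ l * (q ^ l / q) ^ N *
    fps_nth (fps_X ^ (r - 1) * grid_ratio q {1..r} a b N) (r - 2 + l - k)"
proof -
  let ?I = "{1..r} \<times> {..N}"
  let ?w = "residue_weight ?I (q_grid q b) ({1..r} \<times> {..<N}) (q_grid q a)"
  have pow: "x ^ (r - 2) * (q / x) ^ k * (x / q) ^ l = q ^ k / q ^ l * x ^ (r - 2 + l - k)"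
    if "x \<noteq> 0" for x
    using that k by (simp add: power_divide power_add power_diff mult_ac)
  have "(\<Sum>p\<in>?I. ?w p * (q_grid q b p ^ (r - 2) * (q / q_grid q b p) ^ k * (q_grid q b p / q) ^ l))
      = q ^ k / q ^ l * (\<Sum>p\<in>?I. ?w p * q_grid q b p ^ (r - 2 + l - k))"
    unfolding sum_distrib_left by (intro sum.cong refl) (simp only: pow[OF q_grid_nz] mult.left_commute)
  also have "(\<Sum>p\<in>?I. ?w p * q_grid q b p ^ (r - 2 + l - k)) =
      fps_nth (fps_X ^ (r - 1) * grid_ratio q {1..r} a b N) (r - 2 + l - k)"
    unfolding grid_ratio_def by (intro sum_residue_weight_power inj_grid card_grid) auto
  finally show ?thesis
    by (subst M_series_nth[of r q a b, OF r q_nz a0 b0 br]) (simp_all add: mult_ac)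
qed

lemma M_series_eq_0:
  assumes "l \<le> k" "k \<le> r - 2 + l"
  shows "M_series q r a b k l = 0"
  using assms r by (auto simp: fps_eq_iff M_series_nth_grid_ratio fps_X_power_mult_nth)

lemma M_series_superdiagonal: "M_series q r a b k (k + 1) = 1 / (1 - fps_const (q ^ k) * fps_X)"
proof -
  have "fps_nth (grid_ratio q {1..r} a b N) 0 = 1" for N
    by (simp add: grid_ratio_def linear_ratio_def fps_prod_nth_0)
  then have "fps_nth (M_series q r a b k (k + 1)) N = (q ^ k) ^ N" for N
    using r q_nz by (subst M_series_nth_grid_ratio) (simp_all add: fps_X_power_mult_nth Suc_diff_Suc numeral_2_eq_2)
  then show ?thesis
    by (simp add: fps_eq_iff fps_divide_unit inverse_one_minus_const_fps_X)
qed

text \<open>For \<open>(k, l) = (r - 1, 0)\<close> the exponent of \<open>x\<close> is \<open>-1\<close>, and the pole at \<open>0\<close> contributes.\<close>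

lemma M_series_corner:
  "M_series q r a b (r - 1) 0 = fps_const ((- 1) ^ (r + 1) * q ^ r) /
     (fps_const (\<Prod>j=1..r. b j) - fps_const ((\<Prod>j=1..r. a j) * q ^ (r - 1)) * fps_X)"
proof -
  define A where "A = (\<Prod>j=1..r. a j)"
  define B where "B = (\<Prod>j=1..r. b j)"
  have B: "B \<noteq> 0" using b0 by (simp add: B_def)
  have grid: "(\<Prod>p\<in>{1..r} \<times> T. - q_grid q c p) = (\<Prod>t\<in>T. (- 1) ^ r * (\<Prod>j=1..r. c j) / (q ^ r) ^ t)" for c T
  proof -
    have "(\<Prod>p\<in>{1..r} \<times> T. - q_grid q c p) = (\<Prod>j=1..r. \<Prod>t\<in>T. - 1 * c j / q ^ t)"
      by (simp add: prod.cartesian_product case_prod_unfold)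
    also have "\<dots> = (\<Prod>t\<in>T. \<Prod>j=1..r. - 1 * c j / q ^ t)" by (rule prod.swap)
    also have "\<dots> = (\<Prod>t\<in>T. (- 1) ^ r * (\<Prod>j=1..r. c j) / (q ^ r) ^ t)"
      by (simp only: prod.distrib prod_dividef prod_constant card_atLeastAtMost flip: power_mult)
        (simp add: mult.commute)
    finally show ?thesis .
  qed
  have "fps_nth (M_series q r a b (r - 1) 0) N = (- 1) ^ (r + 1) * q ^ r / B * (A * q ^ (r - 1) / B) ^ N" for N
  proof -
    let ?I = "{1..r} \<times> {..N}" and ?J = "{1..r} \<times> {..<N}"
    let ?w = "residue_weight ?I (q_grid q b) ?J (q_grid q a)"
    have pow: "x ^ (r - 2) * (q / x) ^ (r - 1) * (x / q) ^ 0 = q ^ (r - 1) / x" if "x \<noteq> 0" for x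
    proof -
      obtain s where "r = Suc (Suc s)" using r by (metis add_2_eq_Suc le_Suc_ex)
      then show ?thesis using that by (simp add: power_divide)
    qed
    have "(\<Sum>p\<in>?I. ?w p * (q_grid q b p ^ (r - 2) * (q / q_grid q b p) ^ (r - 1) * (q_grid q b p / q) ^ 0))
       = q ^ (r - 1) * (\<Sum>p\<in>?I. ?w p / q_grid q b p)"
      unfolding sum_distrib_left by (intro sum.cong refl) (simp only: pow[OF q_grid_nz], simp)
    also have "(\<Sum>p\<in>?I. ?w p / q_grid q b p) =
        - (\<Prod>p\<in>?J. - q_grid q a p) / (\<Prod>p\<in>?I. - q_grid q b p)"
      using card_grid[of N] by (intro sum_residue_weight_inverse inj_grid q_grid_nz) auto
    also have "\<dots> = - ((- 1) ^ r) / B * (q ^ r * A / B) ^ N"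
    proof -
      have C: "(\<Prod>t<N. 1 / (q ^ r) ^ t) \<noteq> 0" using q_nz by simp
      have split: "(\<Prod>t<N. (- 1) ^ r * c / (q ^ r) ^ t) = ((- 1) ^ r) ^ N * c ^ N * (\<Prod>t<N. 1 / (q ^ r) ^ t)" for c
        by (simp add: prod_dividef power_mult_distrib)
      have inv: "inverse ((- 1) ^ r) = (- 1 :: complex) ^ r" by (simp flip: power_inverse)
      show ?thesis
        unfolding grid A_def[symmetric] B_def[symmetric] lessThan_Suc_atMost[symmetric] prod.lessThan_Suc split
        using C q_nz B by (simp add: field_simps power_mult_distrib flip: power_mult power_add mult_2_right)
    qed
    finally show ?thesis
      using r q_nz
      by (subst M_series_nth[of r q a b, OF r q_nz a0 b0 br]) (simp_all add: power_mult_distrib power_divide power_eq_if[of q r])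
  qed
  moreover have "fps_const ((- 1) ^ (r + 1) * q ^ r) / (fps_const B - fps_const (A * q ^ (r - 1)) * fps_X)
      = fps_const ((- 1) ^ (r + 1) * q ^ r / B) * Abs_fps (\<lambda>N. (A * q ^ (r - 1) / B) ^ N)"
  proof -
    let ?D = "fps_const B - fps_const (A * q ^ (r - 1)) * fps_X" and ?g = "1 - fps_const (A * q ^ (r - 1) / B) * fps_X"
    have "?D = fps_const B * ?g"
      using B by (simp add: right_diff_distrib flip: mult.assoc)
    then have inv: "inverse ?D = fps_const (1 / B) * inverse ?g"
      by (simp only: fps_inverse_mult fps_const_inverse inverse_eq_divide)
    have "fps_nth ?D 0 \<noteq> 0" using B by simp
    then have "fps_const c / ?D = fps_const c * (fps_const (1 / B) * inverse ?g)" for c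
      unfolding inv[symmetric] by (rule fps_divide_unit)
    then show ?thesis
      by (simp only: inverse_one_minus_const_fps_X fps_const_mult times_divide_eq_right mult_1_right flip: mult.assoc)
  qed
  ultimately show ?thesis unfolding A_def B_def by (simp add: fps_eq_iff)
qed

lemma M_series_rational:
  assumes k: "k < r" and l: "l < r"
  shows "M_series q r a b k l \<in> rational_fps (H_field q r a b)"
proof -
  let ?K = "H_field q r a b"
  interpret complex_subring ?K by (rule H_field_subring)
  note gens = H_field_generators[where q = q and r = r and a = a and b = b]
  have qinv: "1 / q \<in> ?K" using H_field_inverse q_nz gens(1) by blast
  consider "l \<le> k" "k \<le> r - 2 + l" | "k = r - 1" "l = 0" | e where "l = Suc (k + e)"
  proof (cases "l \<le> k")
    case True
    then have "k \<le> r - 2 + l \<or> (k = r - 1 \<and> l = 0)" using k r by arith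
    then show thesis using True that by blast
  next
    case False
    then show thesis using that(3)[of "l - Suc k"] by simp
  qed
  then show ?thesis
  proof cases
    case 1
    then show ?thesis using M_series_eq_0 rational_fps_const[OF zero_in] by simp
  next
    case 2
    define B where "B = (\<Prod>j=1..r. b j)"
    define u where "u = (\<Prod>j=1..r. a j) * q ^ (r - 1)"
    have "B \<noteq> 0" using b0 by (simp add: B_def)
    have mem: "B \<in> ?K" "u \<in> ?K" "(- 1) ^ (r + 1) * q ^ r \<in> ?K"
      unfolding B_def u_def using gens by (auto intro!: closed)
    have "fps_of_poly [:B, - u:] = fps_const B - fps_const u * fps_X"
      by (simp add: fps_of_poly_pCons mult.commute flip: fps_const_neg)
    then have "M_series q r a b k l = fps_of_poly [:(- 1) ^ (r + 1) * q ^ r:] / fps_of_poly [:B, - u:]"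
      unfolding 2 M_series_corner fps_of_poly_const B_def u_def by (simp only:)
    then show ?thesis
      unfolding rational_fps_def using mem \<open>B \<noteq> 0\<close>
      by (intro CollectI exI[of _ "[:(- 1) ^ (r + 1) * q ^ r:]"] exI[of _ "[:B, - u:]"] conjI) (auto simp: coeff_pCons intro: closed split: nat.splits)
  next
    case 3
    let ?Y = "Abs_fps (\<lambda>N. fps_nth (grid_ratio q {1..r} a b N) e)"
    have "?Y \<in> rational_fps ?K"
      using gens qinv by (intro grid_ratio_generating_function_rational)
    moreover have "M_series q r a b k l = fps_const (q * q ^ k * (1 / q) ^ l) * (?Y oo (fps_const (q ^ l * (1 / q)) * fps_X))"
    proof (rule fps_ext)
      fix N
      have "k \<le> r - 2 + l" and idx: "r - 2 + l - k = (r - 1) + e"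
        using 3 r by simp_all
      then have "fps_nth (M_series q r a b k l) N =
          q * q ^ k / q ^ l * (q ^ l / q) ^ N * fps_nth (grid_ratio q {1..r} a b N) e"
        by (subst M_series_nth_grid_ratio) (simp_all add: fps_X_power_mult_nth)
      also have "\<dots> = fps_nth (fps_const (q * q ^ k * (1 / q) ^ l) * (?Y oo (fps_const (q ^ l * (1 / q)) * fps_X))) N"
        by (simp only: fps_compose_linear fps_mult_left_const_nth fps_nth_Abs_fps power_one_over times_divide_eq_right
            mult_1_right mult.assoc)
      finally show "fps_nth (M_series q r a b k l) N = \<dots>" .
    qed
    ultimately show ?thesis
      using gens(1) qinv by (simp only:) (intro rational_fps_mult rational_fps_const rational_fps_scale mult_in power_in)
  qed
qed

end

theorem theorem1p2:
  fixes r :: nat and q :: complex and a b :: "nat \<Rightarrow> complex"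
    and \<iota> :: "complex fps \<Rightarrow> 'a :: comm_ring_1" and \<sigma> :: "'a \<Rightarrow> 'a" and h h' :: "nat \<Rightarrow> 'a"
  assumes "r \<ge> 2"
    and "0 < norm q" and "norm q < 1"
    and "\<And>i. i \<in> {1..r} \<Longrightarrow> a i \<noteq> 0"
    and "\<And>i. i \<in> {1..r} \<Longrightarrow> b i \<noteq> 0"
    and "b r = q"
    and "\<And>i j m. i \<in> {1..r} \<Longrightarrow> j \<in> {1..r} \<Longrightarrow> i \<noteq> j \<Longrightarrow> b i / b j \<noteq> q powi (m :: int)"
    and "q_difference_extension q \<iota> \<sigma>"
    and "\<And>i. i \<in> {1..r} \<Longrightarrow> \<sigma> (h i) = \<iota> (fps_const (q / b i)) * h i"
    and "\<And>i. i \<in> {1..r} \<Longrightarrow> h i * h' i = 1"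
  shows "(\<forall>k<r. \<forall>l<r. M_entry q r a b \<iota> \<sigma> h h' k l \<in> \<iota> ` rational_fps (H_field q r a b))
    \<and> (\<forall>k l. l \<le> k \<and> k \<le> r - 1 \<and> (k, l) \<noteq> (r - 1, 0) \<longrightarrow> M_entry q r a b \<iota> \<sigma> h h' k l = 0)
    \<and> M_entry q r a b \<iota> \<sigma> h h' (r - 1) 0 =
        \<iota> (fps_const ((- 1) ^ (r + 1) * q ^ r) /
            (fps_const (\<Prod>j=1..r. b j) - fps_const ((\<Prod>j=1..r. a j) * q ^ (r - 1)) * fps_X))
    \<and> (\<forall>k\<le>r - 2. M_entry q r a b \<iota> \<sigma> h h' k (k + 1) = \<iota> (1 / (1 - fps_const (q ^ k) * fps_X)))"
proof -
  interpret generic_parameters q r a b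
    using assms(1-7) by unfold_locales
  interpret q_difference_extension q \<iota> \<sigma> by fact
  have M: "M_entry q r a b \<iota> \<sigma> h h' k l = \<iota> (M_series q r a b k l)" for k l
    using q_nz assms(5,9,10) by (rule M_entry_eq_M_series)
  have "k \<le> r - 2 + l" if "k \<le> r - 1" "(k, l) \<noteq> (r - 1, 0)" for k l
    using that assms(1) by auto
  then show ?thesis
    unfolding M using M_series_rational M_series_eq_0 M_series_corner M_series_superdiagonal \<iota>_zero
    by auto
qed

end
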